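(* Let $\gamma>0$ and $\mathbf u=[u_0,(\mathbf u_\#)^\top]^\top\in\mathbb R^{n+1}$ with $u_0>0$, and write $\overline{\mathbf u}=\mathbf u/u_0$ and $\overline{\mathbf u}_\#=(\overline{\mathbf u})_\#\in\mathbb R^n$. Let $\boldsymbol\alpha_{\mathbf u}^\gamma$ and $\boldsymbol\alpha_{\overline{\mathbf u}}^\gamma$ be the minimizers of $\phi^\gamma(\cdot;\mathbf u)$ and $\phi^\gamma(\cdot;\overline{\mathbf u})$ over $\mathbb R^{n+1}$, respectively. Then $$\boldsymbol\alpha_{\mathbf u}^\gamma=\boldsymbol\alpha_{\overline{\mathbf u}}^\gamma+\Big[\tfrac{\log u_0}{m_0},\mathbf 0^\top\Big]^\top,\qquad\text{where}\quad \boldsymbol\alpha_{\overline{\mathbf u}}^\gamma=\big[\vartheta(\boldsymbol\beta^\gamma_{\overline{\mathbf u}_\#}),(\boldsymbol\beta^\gamma_{\overline{\mathbf u}_\#})^\top\big]^\top .$$ Also, the function $\hat h^\gamma:\mathbb R^n\to\mathbb R$ is strictly convex and $\nabla_{\mathbf w}\hat h^\gamma(\mathbf w)=\boldsymbol\beta^\gamma_{\mathbf w}$ for $\mathbf w\in\mathbb R^n$. Moreover, $h^\gamma(\overline{\mathbf u})=\hat h^\gamma(\overline{\mathbf u}_\#)$ and $$h^\gamma(\mathbf u)=u_0\,\hat h^\gamma(\overline{\mathbf u}_\#)+\frac{u_0}{m_0}\log u_0 .$$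
   Context: Write $\langle g\rangle=\int_{\mathbb S^2}g(\mathbf v)\,d\mathbf v$, where $\mathbb S^2$ is the unit sphere in $\mathbb R^3$; $\|\cdot\|$ is the Euclidean norm. Let $N\ge1$ and let $\mathbf m=[m_0,\mathbf m_\#^\top]^\top:\mathbb S^2\to\mathbb R^{n+1}$, $n+1=(N+1)^2$, be the vector of real spherical harmonics up to degree $N$, ordered by degree; $m_0$ is a positive constant function (its value is also written $m_0$), and $\mathbf m_\#$ collects the remaining $n$ entries. For any $\mathbf y=(y_0,\dots,y_n)^\top\in\mathbb R^{n+1}$ set $\mathbf y_\#=(y_1,\dots,y_n)^\top$, and if $y_0\neq 0$ set $\overline{\mathbf y}=\mathbf y/y_0$. For $u_0>0$, $\gamma>0$, define $$\phi^\gamma(\boldsymbol\alpha;\mathbf u)=\langle\exp(\boldsymbol\alpha\cdot\mathbf m)\rangle-\boldsymbol\alpha\cdot\mathbf u+\frac{u_0\gamma}{2}\|\boldsymbol\alpha_\#\|^2,\qquad \boldsymbol\alpha\in\mathbb R^{n+1},$$ and let $\boldsymbol\alpha^\gamma_{\mathbf u}$ be its minimizer over $\boldsymbol\alpha\in\mathbb R^{n+1}$. With $\eta(z)=z\log z-z$ on $[0,\infty)$ (so the Legendre dual is $\eta_*=\exp$), the partially regularized entropy $h^\gamma(\mathbf u)$ is the optimal value of $$\min_{g\ge0}\ \langle\eta(g)\rangle+\frac{1}{2u_0\gamma}\|\langle\mathbf m_\# g\rangle-\mathbf u_\#\|^2\quad\text{s.t. }u_0=\langle m_0 g\rangle,$$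 over nonnegative functions $g$ on $\mathbb S^2$ with finite moments $\langle\mathbf m g\rangle$; by (known) strong duality, $h^\gamma(\mathbf u)=-\phi^\gamma(\boldsymbol\alpha^\gamma_{\mathbf u};\mathbf u)$. For $\boldsymbol\beta\in\mathbb R^n$ define $$\vartheta(\boldsymbol\beta)=-\frac1{m_0}\big(\log m_0+\log\langle\exp(\boldsymbol\beta\cdot\mathbf m_\#)\rangle\big).$$ For $\mathbf w\in\mathbb R^n$ define $\hat\phi^\gamma(\boldsymbol\beta;\mathbf w)=\phi^\gamma\big([\vartheta(\boldsymbol\beta),\boldsymbol\beta^\top]^\top;[1,\mathbf w^\top]^\top\big)$, $\boldsymbol\beta^\gamma_{\mathbf w}=\operatorname{argmin}_{\boldsymbol\beta\in\mathbb R^n}\hat\phi^\gamma(\boldsymbol\beta;\mathbf w)$, and $\hat h^\gamma(\mathbf w)=-\hat\phi^\gamma(\boldsymbol\beta^\gamma_{\mathbf w};\mathbf w)$. *)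

theory Defs
  imports "HOL-Analysis.Analysis" "HOL-Library.Discrete_Functions"
begin

section \<open>Integration over the unit sphere\<close>

text \<open>Surface measure of the unit sphere, in spherical coordinates with area element
  $\sin\theta\,d\theta\,d\varphi$; its space is \<open>sphere 0 1\<close>.\<close>

definition sphere_param :: "real \<times> real \<Rightarrow> real ^ 3" where
  "sphere_param = (\<lambda>(\<theta>, \<phi>). vector [sin \<theta> * cos \<phi>, sin \<theta> * sin \<phi>, cos \<theta>])"

definition sphere_measure :: "(real ^ 3) measure" where
  "sphere_measure =
     distr (density (restrict_space lborel ({0..pi} \<times> {0..2 * pi})) (\<lambda>(\<theta>, \<phi>). ennreal (sin \<theta>)))
       (restrict_space borel (sphere 0 1)) sphere_param"

definition bracket :: "(real ^ 3 \<Rightarrow> 'b::{banach, second_countable_topology}) \<Rightarrow> 'b" where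
  "bracket g = (LINT v|sphere_measure. g v)"

section \<open>Real spherical harmonics\<close>

definition legendre_poly :: "nat \<Rightarrow> real poly" where
  "legendre_poly l = smult (1 / (2 ^ l * fact l)) ((pderiv ^^ l) ([:-1, 0, 1:] ^ l))"

text \<open>Orthonormal real spherical harmonic of degree \<open>l\<close> and order \<open>m\<close> (for \<open>\<bar>m\<bar> \<le> l\<close>), without
  Condon--Shortley phase, in Cartesian form: at $v = (\sin\theta\cos\varphi, \sin\theta\sin\varphi, \cos\theta)$
  and with $k = |m|$, the associated Legendre factor is
  $\sin^k\theta\, P_l^{(k)}(\cos\theta)$, and
  $\sin^k\theta\, e^{ik\varphi} = (v_1 + i v_2)^k$.\<close>

definition real_sph_harm :: "nat \<Rightarrow> int \<Rightarrow> real ^ 3 \<Rightarrow> real" where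
  "real_sph_harm l m v =
    (let k = nat \<bar>m\<bar>;
         K = sqrt ((2 * real l + 1) / (4 * pi) * (fact (l - k) / fact (l + k)));
         A = K * poly ((pderiv ^^ k) (legendre_poly l)) (v $ 3);
         z = Complex (v $ 1) (v $ 2) ^ k
     in if m = 0 then A else if m > 0 then sqrt 2 * A * Re z else sqrt 2 * A * Im z)"

text \<open>The harmonics listed by degree, and within a degree by order: the ones of degree \<open>l\<close> are those
  with \<open>l\<^sup>2 \<le> k < (l + 1)\<^sup>2\<close>.\<close>

definition sph_harm_seq :: "nat \<Rightarrow> real ^ 3 \<Rightarrow> real" where
  "sph_harm_seq k = (let l = floor_sqrt k in real_sph_harm l (int k - (int l)\<^sup>2 - int l))"

lemma sph_harm_seq_0: "sph_harm_seq 0 v = 1 / sqrt (4 * pi)"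
  by (simp add: sph_harm_seq_def real_sph_harm_def legendre_poly_def real_sqrt_divide)

section \<open>The regularized entropy problem and its dual\<close>

text \<open>A vector $[y_0, y_\#^\top]^\top \in \mathbb{R}^{n+1}$ is a pair in \<open>real \<times> real ^ 'n\<close>, with the
  Euclidean inner product and norm of the product space. In the following, \<open>m\<close> is the vector of
  basis functions and \<open>m0\<close> is the constant value of its first entry.\<close>

definition normalize_mom :: "real \<times> (real ^ 'n) \<Rightarrow> real \<times> (real ^ 'n)" where
  "normalize_mom y = y /\<^sub>R fst y"

definition dual_obj ::
  "(real ^ 3 \<Rightarrow> real \<times> (real ^ 'n)) \<Rightarrow> real \<Rightarrow> real \<times> (real ^ 'n) \<Rightarrow> real \<times> (real ^ 'n) \<Rightarrow> real" where
  "dual_obj m \<gamma> u \<alpha> =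
     bracket (\<lambda>v. exp (\<alpha> \<bullet> m v)) - \<alpha> \<bullet> u + fst u * \<gamma> / 2 * (norm (snd \<alpha>))\<^sup>2"

definition alpha_opt ::
  "(real ^ 3 \<Rightarrow> real \<times> (real ^ 'n)) \<Rightarrow> real \<Rightarrow> real \<times> (real ^ 'n) \<Rightarrow> real \<times> (real ^ 'n)" where
  "alpha_opt m \<gamma> u = arg_min (dual_obj m \<gamma> u) (\<lambda>_. True)"

text \<open>Since \<open>ln 0 = 0\<close>, this gives \<open>ent 0 = 0\<close>, as it should be.\<close>

definition ent :: "real \<Rightarrow> real" where
  "ent z = z * ln z - z"

definition feasible ::
  "(real ^ 3 \<Rightarrow> real \<times> (real ^ 'n)) \<Rightarrow> real \<times> (real ^ 'n) \<Rightarrow> (real ^ 3 \<Rightarrow> real) set" where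
  "feasible m u =
     {g. g \<in> borel_measurable sphere_measure \<and> (\<forall>v \<in> sphere 0 1. 0 \<le> g v) \<and>
         integrable sphere_measure (\<lambda>v. g v *\<^sub>R m v) \<and> fst u = bracket (\<lambda>v. fst (m v) * g v)}"

text \<open>As \<open>ent \<ge> -1\<close> on $[0,\infty)$ and the sphere has finite measure, the entropy of a
  nonnegative \<open>g\<close> is either finite or $+\infty$.\<close>

definition primal_obj ::
  "(real ^ 3 \<Rightarrow> real \<times> (real ^ 'n)) \<Rightarrow> real \<Rightarrow> real \<times> (real ^ 'n) \<Rightarrow> (real ^ 3 \<Rightarrow> real) \<Rightarrow> ereal" where
  "primal_obj m \<gamma> u g =
     (if integrable sphere_measure (\<lambda>v. ent (g v))
      then ereal (bracket (\<lambda>v. ent (g v))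
        + 1 / (2 * fst u * \<gamma>) * (norm (bracket (\<lambda>v. g v *\<^sub>R snd (m v)) - snd u))\<^sup>2)
      else \<infinity>)"

definition reg_entropy ::
  "(real ^ 3 \<Rightarrow> real \<times> (real ^ 'n)) \<Rightarrow> real \<Rightarrow> real \<times> (real ^ 'n) \<Rightarrow> ereal" where
  "reg_entropy m \<gamma> u = (INF g \<in> feasible m u. primal_obj m \<gamma> u g)"

section \<open>The reduced dual problem\<close>

definition theta :: "real \<Rightarrow> (real ^ 3 \<Rightarrow> real \<times> (real ^ 'n)) \<Rightarrow> real ^ 'n \<Rightarrow> real" where
  "theta m0 m \<beta> = - (1 / m0) * (ln m0 + ln (bracket (\<lambda>v. exp (\<beta> \<bullet> snd (m v)))))"

definition red_dual_obj ::
  "real \<Rightarrow> (real ^ 3 \<Rightarrow> real \<times> (real ^ 'n)) \<Rightarrow> real \<Rightarrow> real ^ 'n \<Rightarrow> real ^ 'n \<Rightarrow> real" where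
  "red_dual_obj m0 m \<gamma> w \<beta> = dual_obj m \<gamma> (1, w) (theta m0 m \<beta>, \<beta>)"

definition beta_opt ::
  "real \<Rightarrow> (real ^ 3 \<Rightarrow> real \<times> (real ^ 'n)) \<Rightarrow> real \<Rightarrow> real ^ 'n \<Rightarrow> real ^ 'n" where
  "beta_opt m0 m \<gamma> w = arg_min (red_dual_obj m0 m \<gamma> w) (\<lambda>_. True)"

definition red_entropy ::
  "real \<Rightarrow> (real ^ 3 \<Rightarrow> real \<times> (real ^ 'n)) \<Rightarrow> real \<Rightarrow> real ^ 'n \<Rightarrow> real" where
  "red_entropy m0 m \<gamma> w = - red_dual_obj m0 m \<gamma> w (beta_opt m0 m \<gamma> w)"

definition strictly_convex :: "('a::real_vector \<Rightarrow> real) \<Rightarrow> bool" where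
  "strictly_convex f \<longleftrightarrow>
     (\<forall>x y t. x \<noteq> y \<longrightarrow> 0 < t \<longrightarrow> t < 1 \<longrightarrow>
        f ((1 - t) *\<^sub>R x + t *\<^sub>R y) < (1 - t) * f x + t * f y)"

end

theory Submission
  imports Defs
begin

text \<open>
  Put \<open>Z \<beta> = \<langle>exp (\<beta> \<bullet> m\<^sub>#)\<rangle>\<close>. As \<open>m\<^sub>0\<close> is constant, \<open>\<langle>exp (\<alpha> \<bullet> m)\<rangle>\<close> is
  \<open>exp (\<alpha>\<^sub>0 m\<^sub>0) Z (\<alpha>\<^sub>#)\<close>, and \<open>\<theta> \<beta>\<close> is the value of \<open>\<alpha>\<^sub>0\<close> for which this exponential carries unit
  zeroth moment. Measuring the deviation from it by \<open>t = m\<^sub>0 (\<alpha>\<^sub>0 - \<theta> \<beta>) - ln u\<^sub>0\<close> splits the dual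
  objective exactly (lemma \<open>dual_obj_decomposition\<close>):
  \<open>\<phi>(\<alpha>; u) = u\<^sub>0 \<phi>'(\<beta>; u\<^sub># / u\<^sub>0) + (u\<^sub>0 / m\<^sub>0) (exp t - 1 - t) - (u\<^sub>0 / m\<^sub>0) ln u\<^sub>0\<close>, where \<open>\<phi>'\<close> is the
  reduced objective. The middle term is nonnegative and vanishes only for \<open>t = 0\<close>. So minimising over
  \<open>\<alpha>\<close> is minimising the reduced objective over \<open>\<beta>\<close> and then solving \<open>t = 0\<close> for \<open>\<alpha>\<^sub>0\<close>; the shift by
  \<open>ln u\<^sub>0 / m\<^sub>0\<close> and the formula for the optimal value are read off.

  The reduced objective is \<open>F \<beta> - \<beta> \<bullet> w\<close>, where, up to a constant,
  \<open>F = ln Z / m\<^sub>0 + (\<gamma> / 2) \<parallel>\<cdot>\<parallel>\<^sup>2\<close>. The log-partition function \<open>ln Z\<close> is differentiable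
  (lemma \<open>GDERIV_ln_Z\<close>) and lies above its tangents by Jensen's inequality
  (lemma \<open>ln_Z_tangent\<close>), so \<open>F\<close> is differentiable and strongly convex. Hence the reduced problem has
  exactly one minimiser, and the reduced entropy is the convex conjugate of \<open>F\<close>. Strong convexity of
  \<open>F\<close> makes the conjugate differentiable, with the minimiser as gradient
  (lemma \<open>GDERIV_conjugate\<close>); differentiability of \<open>F\<close> makes the conjugate strictly convex
  (lemma \<open>strictly_convex_conjugate\<close>).

  Finally, the primal value at a feasible \<open>g\<close> plus the dual value at \<open>\<alpha>\<close> is the integral of a
  Fenchel--Young defect plus a square (lemma \<open>duality_gap\<close>). Both are nonnegative, and both vanish for
  the optimal \<open>\<alpha>\<close> and \<open>g = exp (\<alpha> \<bullet> m)\<close>, the square because of the first-order condition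
  \<open>\<nabla>F \<beta> = w\<close>. So the regularised entropy is minus the optimal dual value.
\<close>

section \<open>Smooth strongly convex functions and their conjugates\<close>

text \<open>Differentiability is obtained twice from a quadratic bound on the linearisation error: for the
  partition function by a Taylor estimate, and for a conjugate by squeezing it between a tangent and a parabola touching that tangent.\<close>

lemma GDERIV_quadratic_sandwich:
  fixes f :: "'b::real_inner \<Rightarrow> real"
  assumes "\<delta> > 0"
    and bound: "\<And>y. norm (y - x) < \<delta> \<Longrightarrow> \<bar>f y - f x - (y - x) \<bullet> D\<bar> \<le> C * (norm (y - x))\<^sup>2"
  shows "GDERIV f x :> D"
  unfolding gderiv_def
proof (rule has_derivativeI_sandwich[where e=\<delta> and H="\<lambda>y. C * norm (y - x)"])
  show "\<delta> > 0" by fact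
  show "bounded_linear (\<lambda>h. h \<bullet> D)" by (rule bounded_linear_inner_left)
  show "((\<lambda>y. C * norm (y - x)) \<longlongrightarrow> 0) (at x)"
    by (rule tendsto_eq_intros refl | simp)+
next
  fix y assume "y \<in> UNIV" "y \<noteq> x" "dist y x < \<delta>"
  then have "\<bar>f y - f x - (y - x) \<bullet> D\<bar> \<le> C * norm (y - x) * norm (y - x)" "norm (y - x) > 0"
    using bound[of y] by (auto simp: dist_norm power2_eq_square)
  then show "norm (f y - f x - (y - x) \<bullet> D) / norm (y - x) \<le> C * norm (y - x)"
    by (simp add: divide_le_eq)
qed

text \<open>Strong convexity is assumed in its first-order form, a quadratic lower bound at every tangent. The
  minimisers of the tilted functions \<open>F y - y \<bullet> w\<close> are then exactly the solutions of \<open>D x = w\<close>.\<close>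

locale strongly_convex_potential =
  fixes F :: "'b::euclidean_space \<Rightarrow> real" and D :: "'b \<Rightarrow> 'b" and \<gamma> :: real
  assumes modulus_pos: "\<gamma> > 0"
    and gradient: "\<And>x. GDERIV F x :> D x"
    and growth: "\<And>x y. F x + (y - x) \<bullet> D x + \<gamma> / 2 * (norm (y - x))\<^sup>2 \<le> F y"
begin

lemma tilted_growth:
  assumes "D x = w"
  shows "F x - x \<bullet> w + \<gamma> / 2 * (norm (y - x))\<^sup>2 \<le> F y - y \<bullet> w"
  using growth[of x y] assms by (simp add: inner_diff_left)

lemma gradient_eq_if_tilted_min:
  assumes "\<And>y. F x - x \<bullet> w \<le> F y - y \<bullet> w"
  shows "D x = w"
proof -
  have "((\<lambda>y. F y - y \<bullet> w) has_derivative (\<lambda>h. h \<bullet> D x - h \<bullet> w)) (at x)"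
    using gradient[of x] unfolding gderiv_def
    by (intro has_derivative_diff bounded_linear.has_derivative[OF bounded_linear_inner_left]) auto
  then have "(\<lambda>h. h \<bullet> D x - h \<bullet> w) = (\<lambda>h. 0)"
    by (rule differential_zero_maxmin[where S=UNIV, rotated 2]) (use assms in auto)
  then have "(D x - w) \<bullet> (D x - w) = 0"
    by (metis inner_diff_right)
  then show ?thesis by simp
qed

text \<open>The function \<open>F y - y \<bullet> w\<close> is coercive: by the quadratic growth at \<open>0\<close> its values beyond some
  radius exceed the one at \<open>0\<close>. So it attains its minimum, where the gradient vanishes.\<close>

lemma gradient_surj: "\<exists>x. D x = w"
proof -
  \<comment> \<open>the radius beyond which the quadratic term beats the linear one\<close>
  define R where "R = 2 * norm (D 0 - w) / \<gamma>"
  have R: "R \<ge> 0" using modulus_pos by (simp add: R_def)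
  have "continuous_on (cball 0 R) (\<lambda>y. F y - y \<bullet> w)"
    using gradient unfolding gderiv_def
    by (intro continuous_intros) (meson continuous_at_imp_continuous_on has_derivative_continuous)
  then obtain x where x: "x \<in> cball 0 R" "\<And>y. y \<in> cball 0 R \<Longrightarrow> F x - x \<bullet> w \<le> F y - y \<bullet> w"
    using continuous_attains_inf[of "cball 0 R" "\<lambda>y. F y - y \<bullet> w"] R by auto
  have "F x - x \<bullet> w \<le> F y - y \<bullet> w" for y
  proof (cases "y \<in> cball 0 R")
    case False
    then have "2 * norm (D 0 - w) \<le> \<gamma> * norm y"
      using modulus_pos by (simp add: R_def field_simps)
    then have "2 * norm (D 0 - w) * norm y \<le> \<gamma> * norm y * norm y"
      by (rule mult_right_mono) simp
    moreover have "- (norm y * norm (D 0 - w)) \<le> y \<bullet> (D 0 - w)"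
      using Cauchy_Schwarz_ineq2[of y "D 0 - w"] by linarith
    ultimately have "0 \<le> y \<bullet> (D 0 - w) + \<gamma> / 2 * (norm y)\<^sup>2"
      by (simp add: power2_eq_square algebra_simps)
    then have "F 0 \<le> F y - y \<bullet> w"
      using growth[of 0 y] by (simp add: inner_diff_right)
    moreover have "F x - x \<bullet> w \<le> F 0" using x(2)[of 0] R by simp
    ultimately show ?thesis by linarith
  qed (use x in blast)
  then show ?thesis using gradient_eq_if_tilted_min by blast
qed

lemma is_arg_min_tilted_iff: "is_arg_min (\<lambda>y. F y - y \<bullet> w) (\<lambda>_. True) x \<longleftrightarrow> D x = w"
proof
  assume "D x = w"
  then have "F x - x \<bullet> w \<le> F y - y \<bullet> w" for y
    using tilted_growth[of x w y] modulus_pos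
    by (smt (verit) zero_le_mult_iff zero_le_power2 half_gt_zero)
  then show "is_arg_min (\<lambda>y. F y - y \<bullet> w) (\<lambda>_. True) x"
    by (auto simp: is_arg_min_def not_less)
qed (auto simp: is_arg_min_def not_less intro: gradient_eq_if_tilted_min)

lemma gradient_inj: "D x = D y \<Longrightarrow> x = y"
proof -
  assume "D x = D y"
  then have "\<gamma> * (norm (y - x))\<^sup>2 \<le> 0"
    using tilted_growth[of x "D x" y] tilted_growth[of y "D x" x]
    by (simp add: norm_minus_commute)
  then show ?thesis
    using modulus_pos by (simp add: mult_le_0_iff)
qed

lemma ex1_tilted_arg_min: "\<exists>!x. is_arg_min (\<lambda>y. F y - y \<bullet> w) (\<lambda>_. True) x"
  unfolding is_arg_min_tilted_iff using gradient_surj gradient_inj by metis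

definition tilted_min :: "'b \<Rightarrow> 'b" where
  "tilted_min w = arg_min (\<lambda>y. F y - y \<bullet> w) (\<lambda>_. True)"

lemma gradient_tilted_min: "D (tilted_min w) = w"
  unfolding tilted_min_def arg_min_def is_arg_min_tilted_iff
  using gradient_surj by (rule someI_ex)

text \<open>The supremum of \<open>y \<bullet> w - F y\<close> over \<open>y\<close>, written as the value at the point where it is attained.\<close>

definition conjugate :: "'b \<Rightarrow> real" where
  "conjugate w = tilted_min w \<bullet> w - F (tilted_min w)"

text \<open>The quantitative Fenchel inequality: the distance of \<open>y\<close> from the maximiser is paid for
  quadratically. Equality therefore singles out the maximiser.\<close>

lemma conjugate_ge: "y \<bullet> w - F y + \<gamma> / 2 * (norm (y - tilted_min w))\<^sup>2 \<le> conjugate w"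
  using tilted_growth[OF gradient_tilted_min, of w y] by (simp add: conjugate_def)

lemma conjugate_ge_pairing: "y \<bullet> w - F y \<le> conjugate w"
proof -
  have "0 \<le> \<gamma> / 2 * (norm (y - tilted_min w))\<^sup>2" using modulus_pos by simp
  then show ?thesis using conjugate_ge[of y w] by linarith
qed

lemma eq_tilted_min_if_conjugate_eq:
  assumes "conjugate w = y \<bullet> w - F y"
  shows "y = tilted_min w"
proof -
  have "\<gamma> * (norm (y - tilted_min w))\<^sup>2 \<le> 0"
    using conjugate_ge[of y w] assms by simp
  then show ?thesis
    using modulus_pos by (simp add: mult_le_0_iff)
qed

text \<open>As a supremum of affine functions, the conjugate lies above its tangent with slope
  \<open>tilted_min w\<close>. Its excess at \<open>v\<close> is at most \<open>d \<bullet> e - (\<gamma> / 2) \<parallel>d\<parallel>\<^sup>2\<close>, where \<open>d\<close> is the move of the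
  minimiser and \<open>e = v - w\<close>; completing the square bounds this by \<open>\<parallel>e\<parallel>\<^sup>2 / (2 \<gamma>)\<close>.\<close>

lemma GDERIV_conjugate: "GDERIV conjugate w :> tilted_min w"
proof (rule GDERIV_quadratic_sandwich[of 1 _ _ _ "1 / (2 * \<gamma>)"])
  fix v
  let ?b = "tilted_min w" and ?b' = "tilted_min v"
  have "?b \<bullet> v - F ?b \<le> conjugate v"
    by (rule conjugate_ge_pairing)
  then have lower: "0 \<le> conjugate v - conjugate w - (v - w) \<bullet> ?b"
    by (simp add: conjugate_def inner_diff_left inner_diff_right inner_commute)
  have upper: "conjugate v - conjugate w - (v - w) \<bullet> ?b
      \<le> (?b' - ?b) \<bullet> (v - w) - \<gamma> / 2 * (norm (?b' - ?b))\<^sup>2"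
    using conjugate_ge[of ?b' w]
    by (simp add: conjugate_def inner_diff_left inner_diff_right inner_commute)
  have square: "(norm (\<gamma> *\<^sub>R d - e))\<^sup>2 = \<gamma>\<^sup>2 * (norm d)\<^sup>2 - 2 * \<gamma> * (d \<bullet> e) + (norm e)\<^sup>2" for d e :: 'b
    by (simp add: power2_norm_eq_inner power2_eq_square[of \<gamma>] inner_diff_left inner_diff_right inner_commute algebra_simps)
  have "(norm (\<gamma> *\<^sub>R d - e))\<^sup>2 / (2 * \<gamma>)
      = \<gamma> / 2 * (norm d)\<^sup>2 - d \<bullet> e + 1 / (2 * \<gamma>) * (norm e)\<^sup>2" for d e :: 'b
    unfolding square using modulus_pos by (simp add: field_simps power2_eq_square)
  then have "0 \<le> \<gamma> / 2 * (norm (?b' - ?b))\<^sup>2 - (?b' - ?b) \<bullet> (v - w) + 1 / (2 * \<gamma>) * (norm (v - w))\<^sup>2"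
    using modulus_pos by (metis divide_nonneg_pos mult_pos_pos zero_le_power2 zero_less_numeral)
  then show "\<bar>conjugate v - conjugate w - (v - w) \<bullet> ?b\<bar> \<le> 1 / (2 * \<gamma>) * (norm (v - w))\<^sup>2"
    using lower upper by linarith
qed simp

text \<open>An affine piece of the conjugate on a segment would make one point the maximiser for both
  ends \<open>x\<close> and \<open>y\<close>; but the gradient of \<open>F\<close> at that point has only one value, so \<open>x = y\<close>.\<close>

lemma strictly_convex_conjugate: "strictly_convex conjugate"
  unfolding strictly_convex_def
proof (intro allI impI)
  fix x y :: 'b and t :: real
  assume neq: "x \<noteq> y" and t: "0 < t" "t < 1"
  define z where "z = (1 - t) *\<^sub>R x + t *\<^sub>R y"
  let ?b = "tilted_min z"
  have weak: "?b \<bullet> v - F ?b \<le> conjugate v" for v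
    by (rule conjugate_ge_pairing)
  have strict: "?b \<bullet> v - F ?b < conjugate v" if "?b \<noteq> tilted_min v" for v
    using weak[of v] eq_tilted_min_if_conjugate_eq[of v ?b] that by force
  have "?b \<noteq> tilted_min x \<or> ?b \<noteq> tilted_min y"
    using neq gradient_tilted_min by metis
  then have "(1 - t) * (?b \<bullet> x - F ?b) + t * (?b \<bullet> y - F ?b) < (1 - t) * conjugate x + t * conjugate y"
  proof
    assume "?b \<noteq> tilted_min x"
    then show ?thesis
      using t weak[of y] strict[of x] by (intro add_less_le_mono mult_strict_left_mono mult_left_mono) auto
  next
    assume "?b \<noteq> tilted_min y"
    then show ?thesis
      using t weak[of x] strict[of y] by (intro add_le_less_mono mult_strict_left_mono mult_left_mono) auto
  qed
  moreover have "conjugate z = (1 - t) * (?b \<bullet> x - F ?b) + t * (?b \<bullet> y - F ?b)"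
    by (simp add: conjugate_def) (simp add: z_def inner_add_right algebra_simps)
  ultimately show "conjugate ((1 - t) *\<^sub>R x + t *\<^sub>R y) < (1 - t) * conjugate x + t * conjugate y"
    by (simp add: z_def)
qed

end

section \<open>Log-partition function of a bounded statistic\<close>

lemma exp_second_order_remainder:
  fixes x :: real
  shows "\<bar>exp x - 1 - x\<bar> \<le> x\<^sup>2 * exp \<bar>x\<bar>"
proof -
  have "(1 - x) * exp x \<le> exp (- x) * exp x"
    using exp_ge_add_one_self[of "- x"] by (intro mult_right_mono) auto
  then have 1: "exp x - 1 - x \<le> x * (exp x - 1)"
    by (simp add: exp_minus algebra_simps)
  have 2: "\<bar>exp x - 1\<bar> \<le> \<bar>x\<bar> * exp \<bar>x\<bar>"
  proof (cases "x \<ge> 0")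
    case True
    then show ?thesis using 1 by (simp add: algebra_simps)
  next
    case False
    then have "\<bar>exp x - 1\<bar> \<le> \<bar>x\<bar> * 1" using exp_ge_add_one_self[of x] by (simp del: exp_ge_add_one_self)
    also have "\<dots> \<le> \<bar>x\<bar> * exp \<bar>x\<bar>" by (intro mult_left_mono) auto
    finally show ?thesis .
  qed
  have "x * (exp x - 1) \<le> \<bar>x\<bar> * \<bar>exp x - 1\<bar>" by (simp flip: abs_mult)
  also have "\<dots> \<le> \<bar>x\<bar> * (\<bar>x\<bar> * exp \<bar>x\<bar>)" using 2 by (intro mult_left_mono) auto
  finally show ?thesis
    using 1 exp_ge_add_one_self[of x] unfolding power2_eq_square mult.assoc[symmetric] by linarith
qed

text \<open>The exponential family \<open>exp (\<beta> \<bullet> f)\<close> of a bounded statistic on a nonzero finite measure: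
  boundedness makes every integral below converge for all \<open>\<beta>\<close>.\<close>

locale bounded_statistic = finite_measure M for M :: "'a measure" +
  fixes f :: "'a \<Rightarrow> 'b::euclidean_space" and B :: real
  assumes nontrivial: "emeasure M (space M) \<noteq> 0"
    and f_measurable [measurable]: "f \<in> borel_measurable M"
    and f_bounded: "\<And>x. x \<in> space M \<Longrightarrow> norm (f x) \<le> B"
begin

definition Z :: "'b \<Rightarrow> real" where
  "Z \<beta> = (LINT x|M. exp (\<beta> \<bullet> f x))"

text \<open>The expectation of the statistic under the probability density \<open>exp (\<beta> \<bullet> f) / Z \<beta>\<close>.\<close>

definition mean :: "'b \<Rightarrow> 'b" where
  "mean \<beta> = (LINT x|M. exp (\<beta> \<bullet> f x) *\<^sub>R f x) /\<^sub>R Z \<beta>"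

lemma abs_inner_statistic_le: "x \<in> space M \<Longrightarrow> \<bar>\<beta> \<bullet> f x\<bar> \<le> norm \<beta> * B"
  using Cauchy_Schwarz_ineq2[of \<beta> "f x"] f_bounded[of x]
  by (meson mult_left_mono norm_ge_zero order_trans)

lemma exp_inner_statistic_le: "x \<in> space M \<Longrightarrow> exp (\<beta> \<bullet> f x) \<le> exp (norm \<beta> * B)"
  using abs_inner_statistic_le[of x \<beta>] by simp

lemma integrable_exp: "integrable M (\<lambda>x. exp (\<beta> \<bullet> f x))"
  by (rule integrable_const_bound[where B="exp (norm \<beta> * B)"])
    (use exp_inner_statistic_le in auto)

lemma integrable_exp_statistic: "integrable M (\<lambda>x. exp (\<beta> \<bullet> f x) *\<^sub>R f x)"
  by (rule integrable_const_bound[where B="exp (norm \<beta> * B) * B"])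
    (use exp_inner_statistic_le f_bounded in \<open>auto intro!: mult_mono\<close>)

lemma integral_exp_inner:
  "(LINT x|M. exp (\<beta> \<bullet> f x) * (d \<bullet> f x)) = d \<bullet> (LINT x|M. exp (\<beta> \<bullet> f x) *\<^sub>R f x)"
  using integral_inner_left[OF integrable_exp_statistic, of \<beta> d]
  by (simp add: inner_commute)

lemma integrable_exp_inner: "integrable M (\<lambda>x. exp (\<beta> \<bullet> f x) * (d \<bullet> f x))"
  using integrable_inner_left[OF integrable_exp_statistic, of \<beta> d]
  by (simp add: inner_commute)

lemma Z_pos: "Z \<beta> > 0"
proof -
  have "(LINT x|M. 0) < (LINT x|M. exp (\<beta> \<bullet> f x))"
    by (rule integral_less_AE_space) (use integrable_exp nontrivial in auto)
  then show ?thesis by (simp add: Z_def)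
qed

lemma Z_mean: "Z \<beta> *\<^sub>R mean \<beta> = (LINT x|M. exp (\<beta> \<bullet> f x) *\<^sub>R f x)"
  using Z_pos[of \<beta>] by (simp add: mean_def)

text \<open>For \<open>\<parallel>h\<parallel> < 1\<close> the exponents \<open>h \<bullet> f x\<close> lie in \<open>[-B, B]\<close>, so the second-order remainder of
  \<open>exp\<close> is bounded uniformly in \<open>x\<close> by a multiple of \<open>\<parallel>h\<parallel>\<^sup>2\<close> and may be integrated.\<close>

lemma GDERIV_Z: "GDERIV Z \<beta> :> Z \<beta> *\<^sub>R mean \<beta>"
proof (rule GDERIV_quadratic_sandwich[of 1 _ _ _ "Z \<beta> * (B\<^sup>2 * exp B)"])
  fix \<beta>' assume near: "norm (\<beta>' - \<beta>) < 1"
  define h where "h = \<beta>' - \<beta>"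
  let ?r = "\<lambda>x. exp (h \<bullet> f x) - 1 - h \<bullet> f x"
  have eq: "exp (\<beta>' \<bullet> f x) - exp (\<beta> \<bullet> f x) - exp (\<beta> \<bullet> f x) * (h \<bullet> f x) = exp (\<beta> \<bullet> f x) * ?r x" for x
    by (simp add: h_def inner_diff_left exp_diff algebra_simps)
  have int: "integrable M (\<lambda>x. exp (\<beta> \<bullet> f x) * ?r x)"
    unfolding eq[symmetric]
    by (intro Bochner_Integration.integrable_diff integrable_exp integrable_exp_inner)
  have r: "\<bar>?r x\<bar> \<le> (norm h)\<^sup>2 * (B\<^sup>2 * exp B)" if "x \<in> space M" for x
  proof -
    have B: "B \<ge> 0" using f_bounded[OF that] by (meson norm_ge_zero order_trans)
    have le: "\<bar>h \<bullet> f x\<bar> \<le> norm h * B" by (rule abs_inner_statistic_le[OF that])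
    have "norm h * B \<le> 1 * B" using near B by (intro mult_right_mono) (auto simp: h_def)
    then have "\<bar>h \<bullet> f x\<bar> \<le> B" using le by simp
    moreover have "(h \<bullet> f x)\<^sup>2 \<le> (norm h * B)\<^sup>2"
      using le by (metis abs_ge_zero power2_abs power_mono)
    ultimately have "(h \<bullet> f x)\<^sup>2 * exp \<bar>h \<bullet> f x\<bar> \<le> (norm h * B)\<^sup>2 * exp B"
      by (intro mult_mono) auto
    then show ?thesis
      using exp_second_order_remainder[of "h \<bullet> f x"] by (simp add: power_mult_distrib mult.assoc)
  qed
  have "Z \<beta>' - Z \<beta> - h \<bullet> (Z \<beta> *\<^sub>R mean \<beta>) = (LINT x|M. exp (\<beta> \<bullet> f x) * ?r x)"
    unfolding eq[symmetric] Z_mean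
    by (simp add: Z_def integral_exp_inner integrable_exp integrable_exp_inner)
  also have "\<bar>\<dots>\<bar> \<le> (LINT x|M. \<bar>exp (\<beta> \<bullet> f x) * ?r x\<bar>)"
    by (rule integral_abs_bound)
  also have "\<dots> \<le> (LINT x|M. exp (\<beta> \<bullet> f x) * ((norm h)\<^sup>2 * (B\<^sup>2 * exp B)))"
    using r
    by (intro integral_mono integrable_abs int integrable_mult_left integrable_exp)
      (simp add: abs_mult)
  also have "\<dots> = Z \<beta> * (B\<^sup>2 * exp B) * (norm h)\<^sup>2"
    by (simp add: Z_def)
  finally show "\<bar>Z \<beta>' - Z \<beta> - (\<beta>' - \<beta>) \<bullet> (Z \<beta> *\<^sub>R mean \<beta>)\<bar> \<le> Z \<beta> * (B\<^sup>2 * exp B) * (norm (\<beta>' - \<beta>))\<^sup>2"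
    by (simp add: h_def)
qed simp

lemma GDERIV_ln_Z: "GDERIV (\<lambda>\<beta>. ln (Z \<beta>)) \<beta> :> mean \<beta>"
  using GDERIV_DERIV_compose[OF GDERIV_Z DERIV_ln[OF Z_pos], of \<beta>] Z_pos[of \<beta>]
  by simp

text \<open>Convexity of the log-partition function in first-order form. Under the density
  \<open>exp (\<beta> \<bullet> f) / Z \<beta>\<close> this is Jensen's inequality for \<open>exp\<close> and the variable \<open>(\<beta>' - \<beta>) \<bullet> f\<close>; it is
  shown by integrating the tangent of \<open>exp\<close> at the mean \<open>a\<close> of this variable.\<close>

lemma ln_Z_tangent: "ln (Z \<beta>) + (\<beta>' - \<beta>) \<bullet> mean \<beta> \<le> ln (Z \<beta>')"
proof -
  define d where "d = \<beta>' - \<beta>"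
  define a where "a = d \<bullet> mean \<beta>"
  have "exp a * ((1 - a) * exp (\<beta> \<bullet> f x) + exp (\<beta> \<bullet> f x) * (d \<bullet> f x)) \<le> exp (\<beta>' \<bullet> f x)" for x
  proof -
    have "exp (\<beta> \<bullet> f x) * exp a * (1 + (d \<bullet> f x - a)) \<le> exp (\<beta> \<bullet> f x) * exp a * exp (d \<bullet> f x - a)"
      by (intro mult_left_mono exp_ge_add_one_self) simp
    also have "\<dots> = exp (\<beta>' \<bullet> f x)"
      by (simp add: d_def inner_diff_left flip: exp_add)
    finally show ?thesis by (simp add: algebra_simps)
  qed
  then have "(LINT x|M. exp a * ((1 - a) * exp (\<beta> \<bullet> f x) + exp (\<beta> \<bullet> f x) * (d \<bullet> f x))) \<le> Z \<beta>'"
    unfolding Z_def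
    by (intro integral_mono integrable_mult_right Bochner_Integration.integrable_add integrable_exp integrable_exp_inner)
  moreover have "(LINT x|M. exp a * ((1 - a) * exp (\<beta> \<bullet> f x) + exp (\<beta> \<bullet> f x) * (d \<bullet> f x)))
      = exp a * ((1 - a) * Z \<beta> + d \<bullet> (Z \<beta> *\<^sub>R mean \<beta>))"
    unfolding Z_mean by (simp add: Z_def integral_exp_inner integrable_exp integrable_exp_inner)
  ultimately have "exp a * Z \<beta> \<le> Z \<beta>'"
    by (simp add: a_def algebra_simps)
  then have "ln (exp a * Z \<beta>) \<le> ln (Z \<beta>')"
    using Z_pos by (intro ln_mono) auto
  then show ?thesis
    using Z_pos[of \<beta>] by (simp add: ln_mult a_def d_def)
qed

text \<open>The quadratic term satisfies the growth condition with equality, and the log-partition function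
  contributes its tangent inequality.\<close>

lemma strongly_convex_potential_ln_Z:
  assumes "m0 > 0" "\<gamma> > 0"
  shows "strongly_convex_potential
    (\<lambda>\<beta>. k + ln (Z \<beta>) / m0 + \<gamma> / 2 * (norm \<beta>)\<^sup>2) (\<lambda>\<beta>. mean \<beta> /\<^sub>R m0 + \<gamma> *\<^sub>R \<beta>) \<gamma>"
proof
  fix x y
  define L where "L = (\<lambda>\<beta>. ln (Z \<beta>))"
  have [derivative_intros]: "(L has_derivative (\<lambda>h. h \<bullet> mean x)) (at x)"
    using GDERIV_ln_Z[of x] by (simp add: L_def gderiv_def)
  have "((\<lambda>\<beta>. k + L \<beta> / m0 + \<gamma> / 2 * (\<beta> \<bullet> \<beta>)) has_derivative
      (\<lambda>h. h \<bullet> mean x / m0 + \<gamma> / 2 * (x \<bullet> h + h \<bullet> x))) (at x)"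
    using assms by (auto intro!: derivative_eq_intros simp: field_simps)
  moreover have "(\<lambda>h. h \<bullet> mean x / m0 + \<gamma> / 2 * (x \<bullet> h + h \<bullet> x)) = (\<lambda>h. h \<bullet> (mean x /\<^sub>R m0 + \<gamma> *\<^sub>R x))"
    by (simp add: fun_eq_iff inner_add_right inner_commute field_simps)
  ultimately show "GDERIV (\<lambda>\<beta>. k + ln (Z \<beta>) / m0 + \<gamma> / 2 * (norm \<beta>)\<^sup>2) x :> (mean x /\<^sub>R m0 + \<gamma> *\<^sub>R x)"
    unfolding gderiv_def power2_norm_eq_inner L_def by simp
  have "ln (Z x) / m0 + (y - x) \<bullet> mean x / m0 \<le> ln (Z y) / m0"
    using ln_Z_tangent[of x y] assms by (simp add: divide_right_mono flip: add_divide_distrib)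
  moreover have "\<gamma> / 2 * (norm x)\<^sup>2 + (y - x) \<bullet> (\<gamma> *\<^sub>R x) + \<gamma> / 2 * (norm (y - x))\<^sup>2 = \<gamma> / 2 * (norm y)\<^sup>2"
    by (simp add: power2_norm_eq_inner inner_diff_left inner_diff_right inner_commute algebra_simps)
  ultimately show "k + ln (Z x) / m0 + \<gamma> / 2 * (norm x)\<^sup>2 + (y - x) \<bullet> (mean x /\<^sub>R m0 + \<gamma> *\<^sub>R x)
      + \<gamma> / 2 * (norm (y - x))\<^sup>2 \<le> k + ln (Z y) / m0 + \<gamma> / 2 * (norm y)\<^sup>2"
    unfolding inner_add_right inner_scaleR_right[of _ "inverse m0"] by (simp only: divide_inverse mult.commute[of "inverse m0"])
qed (use assms in auto)

end

section \<open>Surface measure and spherical harmonics\<close>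

lemma space_sphere_measure [simp]: "space sphere_measure = sphere 0 1"
  by (simp add: sphere_measure_def space_restrict_space)

lemma continuous_on_sphere_param: "continuous_on A sphere_param"
proof -
  have eq: "sphere_param = (\<lambda>p. \<chi> i. if i = 1 then sin (fst p) * cos (snd p)
      else if i = 2 then sin (fst p) * sin (snd p) else cos (fst p))"
    by (auto simp: sphere_param_def fun_eq_iff vec_eq_iff forall_3)
  have "continuous_on A (\<lambda>p. if i = 1 then sin (fst p) * cos (snd p)
      else if i = 2 then sin (fst p) * sin (snd p) else cos (fst p))" for i :: 3
    by (cases "i = 1"; cases "i = 2") (auto intro!: continuous_intros)
  then show ?thesis
    unfolding eq by (rule continuous_on_vec_lambda)
qed

lemma sphere_param_in_sphere: "sphere_param p \<in> sphere 0 1"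
proof -
  have "(norm (sphere_param p))\<^sup>2 = 1"
    by (simp add: sphere_param_def case_prod_unfold norm_vec_def L2_set_def sum_3 power_mult_distrib)
      (metis distrib_left mult_1_right sin_cos_squared_add sin_cos_squared_add2)
  then show ?thesis by (simp add: power2_eq_1_iff) (smt (verit) norm_ge_zero)
qed

abbreviation "angle_measure \<equiv>
  density (restrict_space lborel ({0..pi} \<times> {0..2 * pi})) (\<lambda>(\<theta>::real, \<phi>::real). ennreal (sin \<theta>))"

lemma sphere_param_measurable:
  "sphere_param \<in> measurable angle_measure (restrict_space borel (sphere 0 1))"
proof (rule measurable_restrict_space2)
  have "sphere_param \<in> borel_measurable (restrict_space lborel ({0..pi} \<times> {0..2 * pi}))"
    by (rule measurable_restrict_space1) (simp add: borel_measurable_continuous_onI continuous_on_sphere_param)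
  then show "sphere_param \<in> borel_measurable angle_measure"
    by simp
qed (use sphere_param_in_sphere in blast)

lemma sin_fst_borel:
  "(\<lambda>(\<theta>::real, \<phi>::real). ennreal (sin \<theta>)) \<in> borel_measurable (restrict_space lborel ({0..pi} \<times> {0..2 * pi}))"
proof (rule measurable_restrict_space1)
  have "(\<lambda>p::real \<times> real. sin (fst p)) \<in> borel_measurable lborel"
    by (simp add: borel_measurable_continuous_onI continuous_intros)
  then show "(\<lambda>(\<theta>::real, \<phi>::real). ennreal (sin \<theta>)) \<in> borel_measurable lborel"
    unfolding case_prod_unfold by (rule measurable_compose) simp
qed

lemma angle_rectangle_eq_cbox: "{0..pi} \<times> {0..2 * pi} = cbox (0, 0) (pi, 2 * pi)"
  by (auto simp: cbox_Pair_iff)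

lemma emeasure_sphere_measure:
  "emeasure sphere_measure (sphere 0 1) =
    (\<integral>\<^sup>+p. ennreal (sin (fst p)) \<partial>restrict_space lborel ({0..pi} \<times> {0..2 * pi}))"
proof -
  have "emeasure sphere_measure (sphere 0 1) =
      emeasure angle_measure (sphere_param -` sphere 0 1 \<inter> space angle_measure)"
    unfolding sphere_measure_def
    by (rule emeasure_distr[OF sphere_param_measurable]) (simp add: sets_restrict_space_iff)
  also have "sphere_param -` sphere 0 1 \<inter> space angle_measure = space angle_measure"
    using sphere_param_in_sphere by blast
  also have "emeasure angle_measure (space angle_measure) =
      (\<integral>\<^sup>+p. (case p of (\<theta>, \<phi>) \<Rightarrow> ennreal (sin \<theta>)) * indicator (space angle_measure) p
        \<partial>restrict_space lborel ({0..pi} \<times> {0..2 * pi}))"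
    by (rule emeasure_density[OF sin_fst_borel]) (metis sets.top sets_density)
  also have "\<dots> = (\<integral>\<^sup>+p. ennreal (sin (fst p)) \<partial>restrict_space lborel ({0..pi} \<times> {0..2 * pi}))"
    by (intro nn_integral_cong) (simp add: case_prod_unfold)
  finally show ?thesis .
qed

lemma finite_measure_sphere: "finite_measure sphere_measure"
proof
  let ?R = "restrict_space lborel ({0..pi} \<times> {0..2 * pi})"
  have "(\<integral>\<^sup>+p. ennreal (sin (fst p)) \<partial>?R) \<le> (\<integral>\<^sup>+p. 1 \<partial>?R)"
    by (intro nn_integral_mono) (metis ennreal_1 ennreal_leI sin_le_one)
  also have "\<dots> = emeasure lborel (cbox (0, 0) (pi, 2 * pi))"
    by (simp add: angle_rectangle_eq_cbox space_restrict_space emeasure_restrict_space)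
  also have "\<dots> < \<infinity>"
    by (rule emeasure_lborel_cbox_finite)
  finally show "emeasure sphere_measure (space sphere_measure) \<noteq> \<infinity>"
    by (simp add: emeasure_sphere_measure)
qed

text \<open>The density \<open>sin \<theta>\<close> is positive on the open rectangle of angles, which has positive area.\<close>

lemma sphere_measure_nonzero: "emeasure sphere_measure (space sphere_measure) \<noteq> 0"
proof
  let ?R = "restrict_space lborel ({0..pi} \<times> {0..2 * pi})"
  assume "emeasure sphere_measure (space sphere_measure) = 0"
  then have "(\<integral>\<^sup>+p. ennreal (sin (fst p)) \<partial>?R) = 0"
    by (simp add: emeasure_sphere_measure)
  then have "AE p in ?R. ennreal (sin (fst p)) = 0"
    using sin_fst_borel by (subst (asm) nn_integral_0_iff_AE) (simp_all add: case_prod_unfold)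
  then have "AE p in lborel. p \<in> {0..pi} \<times> {0..2 * pi} \<longrightarrow> ennreal (sin (fst p)) = 0"
    by (subst (asm) AE_restrict_space_iff) (simp_all add: angle_rectangle_eq_cbox)
  then have "AE p in lborel. p \<notin> box (0, 0) (pi, 2 * pi)"
  proof (rule eventually_mono)
    fix p :: "real \<times> real"
    assume "p \<in> {0..pi} \<times> {0..2 * pi} \<longrightarrow> ennreal (sin (fst p)) = 0"
    then show "p \<notin> box (0, 0) (pi, 2 * pi)"
      using sin_gt_zero[of "fst p"]
      by (cases p) (auto simp: box_def Basis_prod_def ennreal_eq_0_iff)
  qed
  then have "emeasure lborel (box (0, 0) (pi, 2 * pi)) = 0"
    by (subst (asm) AE_iff_null_sets[symmetric]) auto
  then show False
    by (simp add: emeasure_lborel_box_eq Basis_prod_def)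
qed

lemma continuous_on_sph_harm_seq: "continuous_on A (sph_harm_seq k)"
proof -
  have "continuous_on A (real_sph_harm l j)" for l j
    unfolding real_sph_harm_def Let_def
    by (cases "j = 0"; cases "j > 0") (auto intro!: continuous_intros simp del: of_nat_add)
  then show ?thesis
    unfolding sph_harm_seq_def Let_def .
qed

section \<open>Reduction of the dual problem\<close>

text \<open>The moments enter the analysis as an exponential family whose zeroth statistic is a positive
  constant, so that its multiplier can be eliminated. The bound \<open>B\<close> is what makes the exponential
  integrals converge for all multipliers.\<close>

locale sphere_moments =
  fixes m :: "real ^ 3 \<Rightarrow> real \<times> (real ^ 'n::finite)" and m0 B \<gamma> :: real
  assumes m0_pos: "m0 > 0" and \<gamma>_pos: "\<gamma> > 0"
    and fst_m: "\<And>v. v \<in> sphere 0 1 \<Longrightarrow> fst (m v) = m0"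
    and m_measurable [measurable]: "m \<in> borel_measurable sphere_measure"
    and m_bounded: "\<And>v. v \<in> sphere 0 1 \<Longrightarrow> norm (m v) \<le> B"
begin

text \<open>The exponential family of all moments supplies the integrability of \<open>exp (\<alpha> \<bullet> m)\<close>; the one of
  the moments of positive degree, below, is the one whose partition function is studied.\<close>

sublocale full: bounded_statistic sphere_measure m B
  using m_bounded sphere_measure_nonzero
  by (auto intro!: bounded_statistic.intro finite_measure_sphere bounded_statistic_axioms.intro)

sublocale bounded_statistic sphere_measure "\<lambda>v. snd (m v)" B
proof unfold_locales
  show "(\<lambda>v. snd (m v)) \<in> borel_measurable sphere_measure"
    by (rule measurable_compose[OF m_measurable]) (simp add: borel_measurable_continuous_onI continuous_intros)
next
  fix v assume "v \<in> space sphere_measure"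
  then show "norm (snd (m v)) \<le> B"
    using m_bounded[of v] norm_snd_le[of "snd (m v)" "fst (m v)"] by simp
qed (rule sphere_measure_nonzero)

text \<open>The constant is the one for which the reduced dual objective is exactly \<open>potential \<beta> - \<beta> \<bullet> w\<close>.\<close>

definition potential :: "real ^ 'n \<Rightarrow> real" where
  "potential \<beta> = (1 + ln m0) / m0 + ln (Z \<beta>) / m0 + \<gamma> / 2 * (norm \<beta>)\<^sup>2"

definition potential_grad :: "real ^ 'n \<Rightarrow> real ^ 'n" where
  "potential_grad \<beta> = mean \<beta> /\<^sub>R m0 + \<gamma> *\<^sub>R \<beta>"

sublocale strongly_convex_potential potential potential_grad \<gamma>
  unfolding potential_def potential_grad_def
  by (rule strongly_convex_potential_ln_Z[OF m0_pos \<gamma>_pos])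

lemma inner_m: "v \<in> sphere 0 1 \<Longrightarrow> (a, b) \<bullet> m v = a * m0 + b \<bullet> snd (m v)"
  using fst_m[of v] by (cases "m v") simp

lemma bracket_exp: "bracket (\<lambda>v. exp ((a, b) \<bullet> m v)) = exp (a * m0) * Z b"
proof -
  have "bracket (\<lambda>v. exp ((a, b) \<bullet> m v)) = (LINT v|sphere_measure. exp (a * m0) * exp (b \<bullet> snd (m v)))"
    unfolding bracket_def
    by (rule Bochner_Integration.integral_cong) (simp_all del: mem_sphere add: inner_m exp_add)
  then show ?thesis by (simp add: Z_def)
qed

lemma theta_eq: "theta m0 m \<beta> = - (ln m0 / m0 + ln (Z \<beta>) / m0)"
  by (simp only: theta_def bracket_def Z_def add_divide_distrib[symmetric]) simp

text \<open>This identity is the purpose of \<open>theta\<close>: the exponential with multipliers \<open>(theta m0 m b, b)\<close>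
  has zeroth moment \<open>1\<close>.\<close>

lemma theta_normalizes: "exp (theta m0 m b * m0) * Z b = 1 / m0"
proof -
  have "theta m0 m b * m0 = - ln (m0 * Z b)"
    using m0_pos Z_pos[of b] by (simp add: theta_eq ln_mult field_simps)
  then have "exp (theta m0 m b * m0) = inverse (m0 * Z b)"
    using m0_pos Z_pos[of b] by (simp add: exp_minus)
  then show ?thesis using m0_pos Z_pos[of b] by (simp add: field_simps)
qed

lemma red_dual_obj_eq_tilted: "red_dual_obj m0 m \<gamma> w = (\<lambda>b. potential b - b \<bullet> w)"
proof
  fix b
  show "red_dual_obj m0 m \<gamma> w b = potential b - b \<bullet> w"
    unfolding red_dual_obj_def dual_obj_def bracket_exp theta_normalizes
    by (simp add: potential_def theta_eq add_divide_distrib)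
qed

lemma beta_opt_eq: "beta_opt m0 m \<gamma> w = tilted_min w"
  by (simp add: beta_opt_def tilted_min_def red_dual_obj_eq_tilted)

lemma red_entropy_eq: "red_entropy m0 m \<gamma> = conjugate"
  by (simp add: fun_eq_iff red_entropy_def conjugate_def red_dual_obj_eq_tilted beta_opt_eq)

text \<open>The scalar \<open>t a b\<close> is the logarithm of the zeroth moment of \<open>exp ((a, b) \<bullet> m)\<close> relative to \<open>u0\<close>,
  and the dual objective depends on \<open>a\<close> only through it.\<close>

lemma dual_obj_decomposition:
  assumes "u0 > 0"
  defines "t \<equiv> \<lambda>a b. m0 * (a - theta m0 m b) - ln u0"
  shows "dual_obj m \<gamma> (u0, u1) (a, b) = u0 * red_dual_obj m0 m \<gamma> (u1 /\<^sub>R u0) b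
    + u0 / m0 * (exp (t a b) - 1 - t a b) - u0 / m0 * ln u0"
proof -
  have "a * m0 = theta m0 m b * m0 + (t a b + ln u0)"
    by (simp add: t_def algebra_simps)
  then have "exp (a * m0) * Z b = (exp (theta m0 m b * m0) * Z b) * (exp (t a b) * u0)"
    using assms(1) by (simp add: exp_add)
  also have "\<dots> = u0 / m0 * exp (t a b)"
    by (simp add: theta_normalizes)
  finally have 1: "dual_obj m \<gamma> (u0, u1) (a, b) =
      u0 / m0 * exp (t a b) - (a * u0 + b \<bullet> u1) + u0 * \<gamma> / 2 * (norm b)\<^sup>2"
    by (simp add: dual_obj_def bracket_exp)
  have "red_dual_obj m0 m \<gamma> (u1 /\<^sub>R u0) b
      = 1 / m0 - (theta m0 m b + inverse u0 * (b \<bullet> u1)) + \<gamma> / 2 * (norm b)\<^sup>2"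
    unfolding red_dual_obj_def dual_obj_def bracket_exp theta_normalizes by simp
  then have 2: "u0 * red_dual_obj m0 m \<gamma> (u1 /\<^sub>R u0) b
      = u0 / m0 - u0 * theta m0 m b - b \<bullet> u1 + u0 * \<gamma> / 2 * (norm b)\<^sup>2"
    using assms(1) by (simp add: field_simps)
  have "u0 / m0 * t a b = a * u0 - u0 * theta m0 m b - u0 / m0 * ln u0"
    using m0_pos by (simp add: t_def field_simps)
  then have "u0 / m0 * (exp (t a b) - 1 - t a b)
      = u0 / m0 * exp (t a b) - u0 / m0 - (a * u0 - u0 * theta m0 m b - u0 / m0 * ln u0)"
    by (simp add: right_diff_distrib)
  then show ?thesis
    unfolding 1 2 by linarith
qed

definition dual_min :: "real \<Rightarrow> real ^ 'n \<Rightarrow> real \<times> (real ^ 'n)" where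
  "dual_min u0 u1 = (let b = tilted_min (u1 /\<^sub>R u0) in (theta m0 m b + ln u0 / m0, b))"

lemma dual_obj_dual_min:
  assumes "u0 > 0"
  shows "dual_obj m \<gamma> (u0, u1) (dual_min u0 u1) = - (u0 * conjugate (u1 /\<^sub>R u0) + u0 / m0 * ln u0)"
  using m0_pos
  by (simp add: dual_min_def Let_def dual_obj_decomposition[OF assms] conjugate_def red_dual_obj_eq_tilted algebra_simps)

text \<open>The excess over the value at \<open>dual_min\<close> is a Fenchel gap in \<open>b\<close> plus a positive multiple of
  \<open>exp t - 1 - t\<close>; a minimiser makes both vanish.\<close>

lemma is_arg_min_dual_obj_iff:
  assumes "u0 > 0"
  shows "is_arg_min (dual_obj m \<gamma> (u0, u1)) (\<lambda>_. True) \<alpha> \<longleftrightarrow> \<alpha> = dual_min u0 u1"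
proof -
  obtain a b where \<alpha>: "\<alpha> = (a, b)" by (cases \<alpha>)
  define w where "w = u1 /\<^sub>R u0"
  define t where "t = m0 * (a - theta m0 m b) - ln u0"
  have gap: "dual_obj m \<gamma> (u0, u1) (a', b') - dual_obj m \<gamma> (u0, u1) (dual_min u0 u1)
      = u0 * (conjugate w - (b' \<bullet> w - potential b')) + u0 / m0 * (exp t' - 1 - t')"
    if "t' = m0 * (a' - theta m0 m b') - ln u0" for a' b' t'
    unfolding dual_obj_dual_min[OF assms] dual_obj_decomposition[OF assms] red_dual_obj_eq_tilted that w_def[symmetric]
    by (simp add: algebra_simps)
  have nonneg1: "0 \<le> u0 * (conjugate w - (b' \<bullet> w - potential b'))" for b'
    using conjugate_ge_pairing[of b' w] assms by simp
  have nonneg2: "0 \<le> u0 / m0 * (exp t' - 1 - t')" for t'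
  proof (rule mult_nonneg_nonneg)
    show "0 \<le> exp t' - 1 - t'"
      using exp_ge_add_one_self[of t'] by linarith
  qed (use assms m0_pos in simp)
  have min: "dual_obj m \<gamma> (u0, u1) (dual_min u0 u1) \<le> dual_obj m \<gamma> (u0, u1) \<alpha>'" for \<alpha>'
    using gap[OF refl, of "fst \<alpha>'" "snd \<alpha>'"] nonneg1[of "snd \<alpha>'"] nonneg2
    by (smt (verit) prod.collapse)
  show ?thesis
  proof
    assume "is_arg_min (dual_obj m \<gamma> (u0, u1)) (\<lambda>_. True) \<alpha>"
    then have "dual_obj m \<gamma> (u0, u1) \<alpha> \<le> dual_obj m \<gamma> (u0, u1) (dual_min u0 u1)"
      unfolding is_arg_min_linorder by blast
    then have "u0 * (conjugate w - (b \<bullet> w - potential b)) = 0" "u0 / m0 * (exp t - 1 - t) = 0"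
      using gap[OF t_def] nonneg1[of b] nonneg2[of t] unfolding \<alpha> by linarith+
    then have b: "conjugate w = b \<bullet> w - potential b" and "exp t - 1 - t = 0"
      using assms m0_pos by auto
    then have "t = 0"
      using exp_minus_greater[of "- t"] by auto
    then have "a = theta m0 m b + ln u0 / m0"
      using m0_pos by (simp add: t_def field_simps)
    moreover have "b = tilted_min w"
      using b by (rule eq_tilted_min_if_conjugate_eq)
    ultimately show "\<alpha> = dual_min u0 u1"
      by (simp add: \<alpha> dual_min_def w_def Let_def)
  next
    assume "\<alpha> = dual_min u0 u1"
    then show "is_arg_min (dual_obj m \<gamma> (u0, u1)) (\<lambda>_. True) \<alpha>"
      using min by (auto simp: is_arg_min_def not_less)
  qed
qed

lemma ex1_dual_arg_min:
  assumes "u0 > 0"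
  shows "\<exists>!\<alpha>. is_arg_min (dual_obj m \<gamma> (u0, u1)) (\<lambda>_. True) \<alpha>"
  by (simp add: is_arg_min_dual_obj_iff[OF assms])

lemma alpha_opt_eq: "u0 > 0 \<Longrightarrow> alpha_opt m \<gamma> (u0, u1) = dual_min u0 u1"
  by (simp add: alpha_opt_def arg_min_def is_arg_min_dual_obj_iff)

section \<open>Strong duality\<close>

text \<open>The moments of a feasible \<open>g\<close> turn \<open>(a, b) \<bullet> (u0, z)\<close> into an integral, which completes the
  entropy to a pointwise Fenchel--Young defect; what is left, \<open>b \<bullet> (z - u1)\<close> and two quadratic terms,
  is a complete square.\<close>

lemma duality_gap:
  assumes "u0 > 0" and g: "g \<in> feasible m (u0, u1)" and ent: "integrable sphere_measure (\<lambda>v. ent (g v))"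
  defines "z \<equiv> bracket (\<lambda>v. g v *\<^sub>R snd (m v))"
  shows "bracket (\<lambda>v. ent (g v)) + 1 / (2 * u0 * \<gamma>) * (norm (z - u1))\<^sup>2 + dual_obj m \<gamma> (u0, u1) (a, b)
    = bracket (\<lambda>v. ent (g v) - g v * ((a, b) \<bullet> m v) + exp ((a, b) \<bullet> m v))
      + 1 / (2 * u0 * \<gamma>) * (norm (z - u1 + (u0 * \<gamma>) *\<^sub>R b))\<^sup>2"
proof -
  let ?S = sphere_measure
  have int: "integrable ?S (\<lambda>v. g v *\<^sub>R m v)" and u0: "u0 = bracket (\<lambda>v. fst (m v) * g v)"
    using g by (auto simp: feasible_def)
  define I where "I = (LINT v|?S. g v *\<^sub>R m v)"
  have "fst I = u0"
    using integral_bounded_linear[OF bounded_linear_fst int] by (simp add: u0 bracket_def I_def mult.commute)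
  moreover have "snd I = z"
    using integral_bounded_linear[OF bounded_linear_snd int] by (simp add: z_def bracket_def I_def)
  ultimately have I: "I = (u0, z)" by (metis prod.collapse)
  have int2: "integrable ?S (\<lambda>v. g v * ((a, b) \<bullet> m v))"
    using integrable_inner_right[OF int, of "(a, b)"] by simp
  have "(LINT v|?S. g v * ((a, b) \<bullet> m v)) = (a, b) \<bullet> I"
    using integral_inner_right[OF int, of "(a, b)"] by (simp add: I_def)
  then have 1: "bracket (\<lambda>v. ent (g v) - g v * ((a, b) \<bullet> m v) + exp ((a, b) \<bullet> m v))
      = bracket (\<lambda>v. ent (g v)) - (a * u0 + b \<bullet> z) + bracket (\<lambda>v. exp ((a, b) \<bullet> m v))"
    using ent int2 full.integrable_exp[of "(a, b)"] by (simp add: bracket_def I)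
  define k where "k = u0 * \<gamma>"
  have k: "k > 0" using assms(1) \<gamma>_pos by (simp add: k_def)
  have square: "(norm (r + k *\<^sub>R b))\<^sup>2 = (norm r)\<^sup>2 + 2 * k * (b \<bullet> r) + k\<^sup>2 * (norm b)\<^sup>2" for r
    by (simp add: power2_norm_eq_inner inner_add_left inner_add_right inner_commute power2_eq_square[of k] algebra_simps)
  have 2: "1 / (2 * k) * (norm (z - u1 + k *\<^sub>R b))\<^sup>2
      = 1 / (2 * k) * (norm (z - u1))\<^sup>2 + b \<bullet> (z - u1) + k / 2 * (norm b)\<^sup>2"
    unfolding square using k by (simp add: field_simps power2_eq_square)
  have kk: "2 * u0 * \<gamma> = 2 * k" "u0 * \<gamma> = k" by (simp_all add: k_def)
  show ?thesis
    unfolding 1 kk 2 dual_obj_def by (simp add: kk inner_diff_right)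
qed

text \<open>The Fenchel--Young inequality for the entropy and its conjugate \<open>exp\<close>.\<close>

lemma ent_ge_linear:
  assumes "z \<ge> 0"
  shows "0 \<le> ent z - z * s + exp s"
proof (cases "z = 0")
  case False
  then have "z * (1 + (s - ln z)) \<le> z * exp (s - ln z)"
    using assms by (intro mult_left_mono exp_ge_add_one_self)
  also have "\<dots> = exp s" using False assms by (simp add: exp_diff)
  finally show ?thesis by (simp add: ent_def algebra_simps)
qed (simp add: ent_def)

lemma ent_exp: "ent (exp s) - exp s * s + exp s = 0"
  by (simp add: ent_def)

lemma weak_duality:
  assumes "u0 > 0" and g: "g \<in> feasible m (u0, u1)"
  shows "ereal (- dual_obj m \<gamma> (u0, u1) \<alpha>) \<le> primal_obj m \<gamma> (u0, u1) g"
proof (cases "integrable sphere_measure (\<lambda>v. ent (g v))")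
  case True
  obtain a b where \<alpha>: "\<alpha> = (a, b)" by (cases \<alpha>)
  have "0 \<le> bracket (\<lambda>v. ent (g v) - g v * ((a, b) \<bullet> m v) + exp ((a, b) \<bullet> m v))"
    unfolding bracket_def using g
    by (intro Bochner_Integration.integral_nonneg_AE AE_I2 ent_ge_linear) (auto simp: feasible_def)
  moreover have "0 \<le> 1 / (2 * u0 * \<gamma>) * (norm (bracket (\<lambda>v. g v *\<^sub>R snd (m v)) - u1 + (u0 * \<gamma>) *\<^sub>R b))\<^sup>2"
    using assms(1) \<gamma>_pos by simp
  ultimately show ?thesis
    using True duality_gap[OF assms True, of a b] by (simp add: primal_obj_def \<alpha>)
qed (simp add: primal_obj_def)

text \<open>The moments of the optimal exponential miss \<open>u1\<close> by exactly the amount that annihilates the square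
  in \<open>duality_gap\<close>: this is the first-order condition \<open>potential_grad b = u1 /\<^sub>R u0\<close> of the reduced
  problem, multiplied by \<open>u0\<close>.\<close>

lemma moments_of_dual_optimal_exp:
  fixes u0 :: real and u1 :: "real ^ 'n"
  assumes "u0 > 0"
  defines "g \<equiv> \<lambda>v. exp (dual_min u0 u1 \<bullet> m v)"
  shows "bracket (\<lambda>v. fst (m v) * g v) = u0"
    and "bracket (\<lambda>v. g v *\<^sub>R snd (m v)) = u1 - (u0 * \<gamma>) *\<^sub>R snd (dual_min u0 u1)"
proof -
  define b where "b = tilted_min (u1 /\<^sub>R u0)"
  define a where "a = theta m0 m b + ln u0 / m0"
  have ab: "dual_min u0 u1 = (a, b)"
    by (simp add: dual_min_def Let_def a_def b_def)
  have "exp (a * m0) = exp (theta m0 m b * m0) * u0"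
    using assms(1) m0_pos by (simp add: a_def distrib_right exp_add)
  then have mass: "exp (a * m0) * Z b = u0 / m0"
    using theta_normalizes[of b] by (metis mult.assoc mult.commute times_divide_eq_right mult_1_right)
  have "bracket (\<lambda>v. fst (m v) * g v) = m0 * bracket (\<lambda>v. exp ((a, b) \<bullet> m v))"
    unfolding bracket_def g_def ab integral_mult_right_zero[symmetric]
    by (rule Bochner_Integration.integral_cong) (simp_all del: mem_sphere add: fst_m)
  then show "bracket (\<lambda>v. fst (m v) * g v) = u0"
    using m0_pos by (simp add: bracket_exp mass)
  have "bracket (\<lambda>v. g v *\<^sub>R snd (m v))
      = (LINT v|sphere_measure. exp (a * m0) *\<^sub>R (exp (b \<bullet> snd (m v)) *\<^sub>R snd (m v)))"
    unfolding bracket_def g_def ab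
    by (rule Bochner_Integration.integral_cong) (simp_all del: mem_sphere add: inner_m exp_add)
  also have "\<dots> = exp (a * m0) *\<^sub>R (Z b *\<^sub>R mean b)"
    unfolding Z_mean by (rule integral_scaleR_right)
  also have "\<dots> = (u0 / m0) *\<^sub>R mean b"
    by (simp add: mass)
  also have "\<dots> = u0 *\<^sub>R (potential_grad b - \<gamma> *\<^sub>R b)"
    by (simp add: potential_grad_def divide_inverse)
  also have "\<dots> = u1 - (u0 * \<gamma>) *\<^sub>R b"
    using assms(1) by (simp add: b_def gradient_tilted_min scaleR_diff_right)
  finally show "bracket (\<lambda>v. g v *\<^sub>R snd (m v)) = u1 - (u0 * \<gamma>) *\<^sub>R snd (dual_min u0 u1)"
    by (simp add: ab)
qed

lemma strong_duality:
  assumes "u0 > 0"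
  shows "reg_entropy m \<gamma> (u0, u1) = ereal (- dual_obj m \<gamma> (u0, u1) (dual_min u0 u1))"
proof (rule antisym)
  define g where "g = (\<lambda>v. exp (dual_min u0 u1 \<bullet> m v))"
  have feas: "g \<in> feasible m (u0, u1)"
    using moments_of_dual_optimal_exp(1)[OF assms, of u1] full.integrable_exp_statistic[of "dual_min u0 u1"]
    by (simp add: feasible_def g_def)
  have "(\<lambda>v. ent (g v)) = (\<lambda>v. exp (dual_min u0 u1 \<bullet> m v) * (dual_min u0 u1 \<bullet> m v) - exp (dual_min u0 u1 \<bullet> m v))"
    using ent_exp by (simp add: fun_eq_iff g_def algebra_simps)
  then have ent: "integrable sphere_measure (\<lambda>v. ent (g v))"
    using full.integrable_exp full.integrable_exp_inner by simp
  have "reg_entropy m \<gamma> (u0, u1) \<le> primal_obj m \<gamma> (u0, u1) g"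
    unfolding reg_entropy_def by (rule INF_lower[OF feas])
  also have "\<dots> = ereal (- dual_obj m \<gamma> (u0, u1) (dual_min u0 u1))"
    using duality_gap[OF assms feas ent, of "fst (dual_min u0 u1)" "snd (dual_min u0 u1)"]
      moments_of_dual_optimal_exp(2)[OF assms, of u1] ent
    by (simp add: primal_obj_def g_def ent_exp bracket_def)
  finally show "reg_entropy m \<gamma> (u0, u1) \<le> ereal (- dual_obj m \<gamma> (u0, u1) (dual_min u0 u1))" .
next
  show "ereal (- dual_obj m \<gamma> (u0, u1) (dual_min u0 u1)) \<le> reg_entropy m \<gamma> (u0, u1)"
    unfolding reg_entropy_def by (rule INF_greatest) (rule weak_duality[OF assms])
qed

corollary reg_entropy_eq:
  assumes "u0 > 0"
  shows "reg_entropy m \<gamma> (u0, u1) = ereal (u0 * conjugate (u1 /\<^sub>R u0) + u0 / m0 * ln u0)"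
  unfolding strong_duality[OF assms] dual_obj_dual_min[OF assms] by simp

end

theorem theorem3:
  fixes N n :: nat
    and idx :: "'n::finite \<Rightarrow> nat"
    and c :: "nat \<Rightarrow> real"
    and m :: "real ^ 3 \<Rightarrow> real \<times> (real ^ 'n)"
    and m0 \<gamma> :: real
    and u :: "real \<times> (real ^ 'n)"
  assumes N: "N \<ge> 1"
    and n: "n + 1 = (N + 1)\<^sup>2"
    and idx: "bij_betw idx UNIV {1..n}"
    and c: "\<And>k. c k \<noteq> 0"
    and m: "\<And>v. v \<in> sphere 0 1 \<Longrightarrow>
              m v = (c 0 * sph_harm_seq 0 v, \<chi> i. c (idx i) * sph_harm_seq (idx i) v)"
    and m0: "m0 > 0" "\<And>v. v \<in> sphere 0 1 \<Longrightarrow> fst (m v) = m0"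
    and \<gamma>: "\<gamma> > 0"
    and u: "fst u > 0"
  shows
    "(\<exists>!\<alpha>. is_arg_min (dual_obj m \<gamma> u) (\<lambda>_. True) \<alpha>)
     \<and> (\<exists>!\<alpha>. is_arg_min (dual_obj m \<gamma> (normalize_mom u)) (\<lambda>_. True) \<alpha>)
     \<and> (\<forall>w. \<exists>!\<beta>. is_arg_min (red_dual_obj m0 m \<gamma> w) (\<lambda>_. True) \<beta>)
     \<and> alpha_opt m \<gamma> u = alpha_opt m \<gamma> (normalize_mom u) + (ln (fst u) / m0, 0)
     \<and> alpha_opt m \<gamma> (normalize_mom u) =
         (theta m0 m (beta_opt m0 m \<gamma> (snd (normalize_mom u))),
          beta_opt m0 m \<gamma> (snd (normalize_mom u)))
     \<and> strictly_convex (red_entropy m0 m \<gamma>)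
     \<and> (\<forall>w. GDERIV (red_entropy m0 m \<gamma>) w :> beta_opt m0 m \<gamma> w)
     \<and> reg_entropy m \<gamma> (normalize_mom u) =
         ereal (red_entropy m0 m \<gamma> (snd (normalize_mom u)))
     \<and> reg_entropy m \<gamma> u =
         ereal (fst u * red_entropy m0 m \<gamma> (snd (normalize_mom u)) + fst u / m0 * ln (fst u))"
proof -
  \<comment> \<open>\<open>m\<close> is prescribed on the sphere only; \<open>h\<close> is its continuous extension by the same formula\<close>
  define h where "h = (\<lambda>v. (c 0 * sph_harm_seq 0 v, \<chi> i. c (idx i) * sph_harm_seq (idx i) v) :: real \<times> (real ^ 'n))"
  have mh: "m v = h v" if "v \<in> sphere 0 1" for v
    using m[OF that] by (simp add: h_def)
  have cont: "continuous_on A h" for A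
    unfolding h_def by (intro continuous_intros continuous_on_sph_harm_seq)
  have "h \<in> borel_measurable sphere_measure"
    unfolding sphere_measure_def measurable_distr_eq1
    by (intro measurable_restrict_space1 borel_measurable_continuous_onI cont)
  then have meas: "m \<in> borel_measurable sphere_measure"
    by (subst measurable_cong[of _ m h]) (auto simp del: mem_sphere intro: mh)
  have "bounded (h ` sphere 0 1)"
    by (intro compact_imp_bounded compact_continuous_image cont compact_sphere)
  then obtain B where B: "\<And>v. v \<in> sphere 0 1 \<Longrightarrow> norm (h v) \<le> B"
    unfolding bounded_iff by blast
  interpret sphere_moments m m0 B \<gamma>
    by unfold_locales (use m0 \<gamma> meas B mh in auto)
  obtain u0 u1 where u01: "u = (u0, u1)" by (cases u)
  have u0: "u0 > 0" using u by (simp add: u01)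
  have norm_u: "normalize_mom (u0, u1) = (1, u1 /\<^sub>R u0)"
    using u0 by (simp add: normalize_mom_def)
  have min_eq: "dual_min u0 u1 = dual_min 1 (u1 /\<^sub>R u0) + (ln u0 / m0, 0)"
    by (simp add: dual_min_def Let_def)
  show ?thesis
    unfolding u01 norm_u red_entropy_eq beta_opt_eq red_dual_obj_eq_tilted snd_conv fst_conv
      alpha_opt_eq[OF u0] alpha_opt_eq[OF zero_less_one] min_eq
      reg_entropy_eq[OF u0] reg_entropy_eq[OF zero_less_one]
    using ex1_dual_arg_min[OF u0] ex1_dual_arg_min[OF zero_less_one] ex1_tilted_arg_min
      strictly_convex_conjugate GDERIV_conjugate
    by (simp add: dual_min_def Let_def)
qed

end
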